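(* Let $\mathbf{L}$ be a complete residuated lattice on the real unit interval satisfying $a\rightarrow\bigvee_{i\in I}b_i=\bigvee_{i\in I}(a\rightarrow b_i)$ for all $a\in[0,1]$ and all families $\{b_i\}\subseteq[0,1]$, and let $C:L^{\mathrm{Var}}\to L^{\mathrm{Var}}$ be a finitary $\mathbf{L}$-closure operator. Then there is a theory $\Sigma$ such that $C=C_\Sigma$, where $C_\Sigma(e)=e^\omega_\Sigma$ for all $e\in L^{\mathrm{Var}}$.
   Context: A complete residuated lattice on $[0,1]$: $\wedge,\vee$ are min, max, $\langle[0,1],\otimes,1\rangle$ is a commutative monoid and $a\otimes b\le c$ iff $a\le b\rightarrow c$. An $\mathbf{L}$-set in $U$ is a map $U\to[0,1]$; $L^U$ is the set of all of them; finite = finite support; rational = rational values; $A\subseteq B$ pointwise $\le$; unions pointwise suprema; $(c\otimes A)(u)=c\otimes A(u)$; $S(A,B)=\bigwedge_u(A(u)\rightarrow B(u))$. $\mathrm{Var}$ is a denumerable set of propositional variables; a formula is $A\Rightarrow B$ with $A,B$ finite rational $\mathbf{L}$-sets in $\mathrm{Var}$; a theory is a (possibly infinite) set of formulas. For $e\in L^{\mathrm{Var}}$: $e^0_\Sigma=e$, $e^{n+1}_\Sigma=e^n_\Sigma\cup\bigcup\{S(A,e^n_\Sigma)\otimes B: A\Rightarrow B\in\Sigma\}$, $e^\omega_\Sigma=\bigcup_{n<\omega}e^n_\Sigma$. An $\mathbf{L}$-closure operator on $U$ is $C:L^U\to L^U$ with $A\subseteq C(A)$, $S(A,B)\le S(C(A),C(B))$,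 $C(C(A))=C(A)$ for all $A,B$; it is finitary if $C(A)=\bigcup\{C(B):B\subseteq A,\ B\text{ finite}\}$ for all $A$. *)

theory Defs
  imports Complex_Main "HOL-Library.Countable" "HOL-Library.Infinite_Typeclass"
begin

typedef unit_interval = "{0..1::real}"
  morphisms real_of_unit unit_of_real
  by (rule exI[of _ 0]) simp

instantiation unit_interval :: complete_linorder
begin

definition less_eq_unit_interval :: "unit_interval \<Rightarrow> unit_interval \<Rightarrow> bool" where
  "a \<le> b \<longleftrightarrow> real_of_unit a \<le> real_of_unit b"

definition less_unit_interval :: "unit_interval \<Rightarrow> unit_interval \<Rightarrow> bool" where
  "a < b \<longleftrightarrow> real_of_unit a < real_of_unit b"

definition inf_unit_interval :: "unit_interval \<Rightarrow> unit_interval \<Rightarrow> unit_interval" where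
  "inf_unit_interval a b = (if a \<le> b then a else b)"

definition sup_unit_interval :: "unit_interval \<Rightarrow> unit_interval \<Rightarrow> unit_interval" where
  "sup_unit_interval a b = (if a \<le> b then b else a)"

definition bot_unit_interval :: unit_interval where
  "bot = unit_of_real 0"

definition top_unit_interval :: unit_interval where
  "top = unit_of_real 1"

(* Inserting 0 (resp. 1) makes the supremum (resp. infimum) of the empty set the least
   (resp. greatest) element; on the reals these are unspecified. *)
definition Sup_unit_interval :: "unit_interval set \<Rightarrow> unit_interval" where
  "Sup X = unit_of_real (Sup (insert 0 (real_of_unit ` X)))"

definition Inf_unit_interval :: "unit_interval set \<Rightarrow> unit_interval" where
  "Inf X = unit_of_real (Inf (insert 1 (real_of_unit ` X)))"

instance
proof
  have rng: "0 \<le> real_of_unit a" "real_of_unit a \<le> 1" for a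
    using real_of_unit[of a] by auto
  have ba: "bdd_above (insert 0 (real_of_unit ` X))" for X
    using rng by (intro bdd_aboveI[of _ 1]) auto
  have bb: "bdd_below (insert 1 (real_of_unit ` X))" for X
    using rng by (intro bdd_belowI[of _ 0]) auto
  have S: "real_of_unit (Sup X) = Sup (insert 0 (real_of_unit ` X))" for X
  proof -
    have "0 \<le> Sup (insert 0 (real_of_unit ` X))"
      by (rule cSup_upper[OF _ ba]) simp
    moreover have "Sup (insert 0 (real_of_unit ` X)) \<le> 1"
      using rng by (intro cSup_least) auto
    ultimately show ?thesis
      unfolding Sup_unit_interval_def by (intro unit_of_real_inverse) simp
  qed
  have I: "real_of_unit (Inf X) = Inf (insert 1 (real_of_unit ` X))" for X
  proof -
    have "Inf (insert 1 (real_of_unit ` X)) \<le> 1"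
      by (rule cInf_lower[OF _ bb]) simp
    moreover have "0 \<le> Inf (insert 1 (real_of_unit ` X))"
      using rng by (intro cInf_greatest) auto
    ultimately show ?thesis
      unfolding Inf_unit_interval_def by (intro unit_of_real_inverse) simp
  qed
  fix x y z :: unit_interval and X :: "unit_interval set"
  show "x < y \<longleftrightarrow> x \<le> y \<and> \<not> y \<le> x"
    by (auto simp: less_eq_unit_interval_def less_unit_interval_def)
  show "x \<le> x" "x \<le> y \<Longrightarrow> y \<le> z \<Longrightarrow> x \<le> z" "x \<le> y \<or> y \<le> x"
    by (auto simp: less_eq_unit_interval_def)
  show "x \<le> y \<Longrightarrow> y \<le> x \<Longrightarrow> x = y"
    by (simp add: less_eq_unit_interval_def flip: real_of_unit_inject)
  show "inf x y \<le> x" "inf x y \<le> y" "x \<le> y \<Longrightarrow> x \<le> z \<Longrightarrow> x \<le> inf y z"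
    "x \<le> sup x y" "y \<le> sup x y" "y \<le> x \<Longrightarrow> z \<le> x \<Longrightarrow> sup y z \<le> x"
    by (auto simp: inf_unit_interval_def sup_unit_interval_def less_eq_unit_interval_def)
  show "Inf X \<le> x" if "x \<in> X"
    unfolding less_eq_unit_interval_def I using that by (intro cInf_lower[OF _ bb]) simp
  show "z \<le> Inf X" if "\<And>x. x \<in> X \<Longrightarrow> z \<le> x"
    unfolding less_eq_unit_interval_def I
    using that rng by (intro cInf_greatest) (auto simp: less_eq_unit_interval_def)
  show "x \<le> Sup X" if "x \<in> X"
    unfolding less_eq_unit_interval_def S using that by (intro cSup_upper[OF _ ba]) simp
  show "Sup X \<le> z" if "\<And>x. x \<in> X \<Longrightarrow> x \<le> z"
    unfolding less_eq_unit_interval_def S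
    using that rng by (intro cSup_least) (auto simp: less_eq_unit_interval_def)
  show "Inf {} = (top :: unit_interval)" "Sup {} = (bot :: unit_interval)"
    by (simp_all add: Inf_unit_interval_def Sup_unit_interval_def
        top_unit_interval_def bot_unit_interval_def)
qed

end

(* The lattice part (min, max, 0 = bot, 1 = top, completeness) is the class instance above. *)
locale residuated_lattice_01 =
  fixes tensor :: "unit_interval \<Rightarrow> unit_interval \<Rightarrow> unit_interval"
    and imp :: "unit_interval \<Rightarrow> unit_interval \<Rightarrow> unit_interval"
  assumes tensor_comm_monoid: "comm_monoid tensor top"
    and adjointness: "tensor a b \<le> c \<longleftrightarrow> a \<le> imp b c"

(* Inclusion and unions of L-sets are the pointwise order and suprema on functions. *)
type_synonym 'u lset = "'u \<Rightarrow> unit_interval"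

definition finite_lset :: "'u lset \<Rightarrow> bool" where
  "finite_lset A \<longleftrightarrow> finite {u. A u \<noteq> bot}"

definition rational_lset :: "'u lset \<Rightarrow> bool" where
  "rational_lset A \<longleftrightarrow> (\<forall>u. real_of_unit (A u) \<in> \<rat>)"

definition scale_lset ::
  "(unit_interval \<Rightarrow> unit_interval \<Rightarrow> unit_interval) \<Rightarrow> unit_interval \<Rightarrow> 'u lset \<Rightarrow> 'u lset" where
  "scale_lset tensor c A = (\<lambda>u. tensor c (A u))"

definition subsethood ::
  "(unit_interval \<Rightarrow> unit_interval \<Rightarrow> unit_interval) \<Rightarrow> 'u lset \<Rightarrow> 'u lset \<Rightarrow> unit_interval" where
  "subsethood imp A B = (INF u. imp (A u) (B u))"

(* The pair (A, B) encodes the formula written A => B. *)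
type_synonym 'v fml = "'v lset \<times> 'v lset"

definition is_formula :: "'v fml \<Rightarrow> bool" where
  "is_formula \<phi> \<longleftrightarrow> (case \<phi> of (A, B) \<Rightarrow>
     finite_lset A \<and> rational_lset A \<and> finite_lset B \<and> rational_lset B)"

definition is_theory :: "'v fml set \<Rightarrow> bool" where
  "is_theory \<Sigma> \<longleftrightarrow> (\<forall>\<phi>\<in>\<Sigma>. is_formula \<phi>)"

primrec iter ::
  "(unit_interval \<Rightarrow> unit_interval \<Rightarrow> unit_interval) \<Rightarrow>
   (unit_interval \<Rightarrow> unit_interval \<Rightarrow> unit_interval) \<Rightarrow>
   'v fml set \<Rightarrow> 'v lset \<Rightarrow> nat \<Rightarrow> 'v lset" where
  "iter tensor imp \<Sigma> e 0 = e"
| "iter tensor imp \<Sigma> e (Suc n) =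
     sup (iter tensor imp \<Sigma> e n)
         (SUP (A, B)\<in>\<Sigma>. scale_lset tensor (subsethood imp A (iter tensor imp \<Sigma> e n)) B)"

definition theory_closure ::
  "(unit_interval \<Rightarrow> unit_interval \<Rightarrow> unit_interval) \<Rightarrow>
   (unit_interval \<Rightarrow> unit_interval \<Rightarrow> unit_interval) \<Rightarrow>
   'v fml set \<Rightarrow> 'v lset \<Rightarrow> 'v lset" where
  "theory_closure tensor imp \<Sigma> e = (SUP n. iter tensor imp \<Sigma> e n)"

definition L_closure_operator ::
  "(unit_interval \<Rightarrow> unit_interval \<Rightarrow> unit_interval) \<Rightarrow> ('u lset \<Rightarrow> 'u lset) \<Rightarrow> bool" where
  "L_closure_operator imp C \<longleftrightarrow>
     (\<forall>A. A \<le> C A) \<and>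
     (\<forall>A B. subsethood imp A B \<le> subsethood imp (C A) (C B)) \<and>
     (\<forall>A. C (C A) = C A)"

definition finitary :: "('u lset \<Rightarrow> 'u lset) \<Rightarrow> bool" where
  "finitary C \<longleftrightarrow> (\<forall>A. C A = Sup {C B | B. B \<le> A \<and> finite_lset B})"

end

theory Submission
  imports Defs
begin

text \<open>
  Take for \<open>\<Sigma>\<close> all formulas \<open>A \<Rightarrow> B\<close> with \<open>B \<subseteq> C(A)\<close>. Every \<open>e\<^sup>n\<close> stays below \<open>C(e)\<close> because \<open>C\<close>
  preserves subsethood degrees. Conversely, already \<open>e\<^sup>1\<close> dominates \<open>C(e)\<close>: by finitarity it suffices
  to bound \<open>C(D)\<close> for a finite \<open>D \<subseteq> e\<close>. As residuation commutes with suprema in its second argument,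
  \<open>D\<close> has finite rational subsets \<open>A\<close> with \<open>S(D, A)\<close> arbitrarily close to \<open>1\<close>; then
  \<open>S(D, A) \<otimes> C(D) \<subseteq> C(A)\<close> makes \<open>C(D)\<close> the union of the \<open>C(A)\<close>, and \<open>C(A)\<close> is the union of the rational
  singletons that it contains, each of which is the consequent of a formula of \<open>\<Sigma>\<close> with
  antecedent \<open>A\<close>.
\<close>

lemma real_of_unit_bot [simp]: "real_of_unit bot = 0"
  by (simp add: bot_unit_interval_def unit_of_real_inverse)

lemma rational_dense_unit:
  assumes "(a::unit_interval) < b"
  obtains q where "a < q" "q < b" "real_of_unit q \<in> \<rat>"
proof -
  from assms obtain r where r: "r \<in> \<rat>" "real_of_unit a < r" "r < real_of_unit b"
    using Rats_dense_in_real unfolding less_unit_interval_def by blast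
  then have "real_of_unit (unit_of_real r) = r"
    using real_of_unit[of a] real_of_unit[of b] by (intro unit_of_real_inverse) auto
  with r that[of "unit_of_real r"] show thesis
    by (simp add: less_unit_interval_def)
qed

text \<open>Otherwise density puts a rational strictly between \<open>y\<close> and
  \<open>x\<close>. With \<open>x = C A v\<close> this brings in rational consequents; with
  \<open>x = top\<close> it leaves only degrees strictly below \<open>top\<close> to test.\<close>

lemma le_if_rationals_below_le:
  fixes x y :: unit_interval
  assumes "\<And>q. real_of_unit q \<in> \<rat> \<Longrightarrow> q < x \<Longrightarrow> q \<le> y"
  shows "x \<le> y"
proof (rule ccontr)
  assume "\<not> x \<le> y"
  then obtain q where "y < q" "q < x" "real_of_unit q \<in> \<rat>"
    using rational_dense_unit[of y x] by (auto simp: not_le)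
  then show False
    using assms[of q] by simp
qed

lemma Sup_rationals_le: "Sup {q. real_of_unit q \<in> \<rat> \<and> q \<le> b} = (b::unit_interval)"
proof (rule antisym)
  show "b \<le> Sup {q. real_of_unit q \<in> \<rat> \<and> q \<le> b}"
    by (rule le_if_rationals_below_le) (auto intro: Sup_upper less_imp_le)
qed (auto intro: Sup_least)

context residuated_lattice_01
begin

lemma tensor_commute: "tensor a b = tensor b a"
  using tensor_comm_monoid
  by (simp add: comm_monoid_def abel_semigroup_def abel_semigroup_axioms_def)

lemma tensor_top_left [simp]: "tensor top a = a"
  using comm_monoid.comm_neutral[OF tensor_comm_monoid, of a] by (simp add: tensor_commute)

lemma imp_eq_top_iff [simp]: "imp a b = top \<longleftrightarrow> a \<le> b"
  using adjointness[of top a b] by (simp add: top_unique)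

lemma tensor_mono:
  assumes "a \<le> b" "c \<le> d"
  shows "tensor a c \<le> tensor b d"
proof -
  have left: "tensor x z \<le> tensor y z" if "x \<le> y" for x y z
    unfolding adjointness using that adjointness[of y z "tensor y z"] by (simp add: order_trans)
  have "tensor a c \<le> tensor b c"
    using left assms by blast
  also have "\<dots> \<le> tensor b d"
    using left[OF assms(2), of b] by (simp add: tensor_commute)
  finally show ?thesis .
qed

lemma subsethood_eq_top: "A \<le> B \<Longrightarrow> subsethood imp A B = top"
  by (simp add: subsethood_def le_fun_def)

lemma tensor_subsethood_le: "tensor (subsethood imp A B) (A u) \<le> B u"
  unfolding adjointness subsethood_def by (rule INF_lower) simp

lemma subsethood_right_mono:
  assumes "B \<le> D"
  shows "subsethood imp A B \<le> subsethood imp A D"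
  unfolding subsethood_def
proof (rule INF_mono')
  fix u
  show "imp (A u) (B u) \<le> imp (A u) (D u)"
    using adjointness[of "imp (A u) (B u)" "A u" "B u"] le_funD[OF assms, of u]
    by (simp add: order_trans flip: adjointness)
qed

text \<open>Preservation of subsethood degrees, moved across the adjunction; both inclusions of the
  theorem use it in this pointwise form.\<close>

lemma tensor_subsethood_closure_le:
  assumes "L_closure_operator imp C"
  shows "tensor (subsethood imp A B) (C A u) \<le> C B u"
proof -
  have "tensor (subsethood imp A B) (C A u) \<le> tensor (subsethood imp (C A) (C B)) (C A u)"
    using assms by (intro tensor_mono) (auto simp: L_closure_operator_def)
  then show ?thesis
    using tensor_subsethood_le by (rule order_trans)
qed

text \<open>Induction on \<open>n\<close>: if the stage lies below \<open>C e\<close>, a formula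
  adds at most S(A, C e) \<otimes> C A, which lies below \<open>C (C e)\<close>, and idempotence
  returns this to \<open>C e\<close>.\<close>

lemma iter_le_closure:
  assumes C: "L_closure_operator imp C"
    and \<Sigma>: "\<And>A B. (A, B) \<in> \<Sigma> \<Longrightarrow> B \<le> C A"
  shows "iter tensor imp \<Sigma> e n \<le> C e"
proof (induction n)
  case 0
  show ?case using C by (simp add: L_closure_operator_def)
next
  case (Suc n)
  have "scale_lset tensor (subsethood imp A (iter tensor imp \<Sigma> e n)) B \<le> C e"
    if "(A, B) \<in> \<Sigma>" for A B
  proof (rule le_funI)
    fix u
    have "tensor (subsethood imp A (iter tensor imp \<Sigma> e n)) (B u)
        \<le> tensor (subsethood imp A (C e)) (C A u)"
      using Suc.IH \<Sigma>[OF that] by (intro tensor_mono subsethood_right_mono) (auto simp: le_fun_def)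
    also have "\<dots> \<le> C (C e) u"
      by (rule tensor_subsethood_closure_le[OF C])
    also have "C (C e) = C e"
      using C by (simp add: L_closure_operator_def)
    finally show "scale_lset tensor (subsethood imp A (iter tensor imp \<Sigma> e n)) B u \<le> C e u"
      by (simp add: scale_lset_def)
  qed
  then show ?case
    using Suc.IH unfolding iter.simps by (intro sup_least SUP_least) auto
qed

lemma rational_subset_approx:
  assumes imp_Sup: "\<And>a X. X \<noteq> {} \<Longrightarrow> imp a (Sup X) = (SUP b\<in>X. imp a b)"
    and D: "finite_lset D" and "c < top"
  obtains A where "A \<le> D" "finite_lset A" "rational_lset A" "c \<le> subsethood imp D A"
proof -
  have "\<exists>q. real_of_unit q \<in> \<rat> \<and> q \<le> D u \<and> c < imp (D u) q" for u
  proof -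
    let ?Q = "{q. real_of_unit q \<in> \<rat> \<and> q \<le> D u}"
    \<comment> \<open>\<open>imp_Sup\<close> speaks of nonempty sets only; \<open>bot\<close> is
      rational and always available.\<close>
    have "bot \<in> ?Q" by simp
    then have "?Q \<noteq> {}" by blast
    then have "(SUP q\<in>?Q. imp (D u) q) = imp (D u) (Sup ?Q)"
      by (rule imp_Sup[symmetric])
    also have "\<dots> = top"
      by (simp add: Sup_rationals_le)
    finally have "(SUP q\<in>?Q. imp (D u) q) = top" .
    \<comment> \<open>Strictness of \<open>c < top\<close> turns the supremum into an actual
      rational witness \<open>q\<close> for each \<open>u\<close>.\<close>
    with \<open>c < top\<close> have "c < (SUP q\<in>?Q. imp (D u) q)"
      by (simp only:)
    then show ?thesis
      unfolding less_SUP_iff by blast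
  qed
  then obtain A where A: "\<And>u. real_of_unit (A u) \<in> \<rat> \<and> A u \<le> D u \<and> c < imp (D u) (A u)"
    by metis
  \<comment> \<open>Choosing values below \<open>D u\<close> forces \<open>bot\<close> off the
    support of \<open>D\<close>, so \<open>A\<close> inherits finiteness.\<close>
  have "{u. A u \<noteq> bot} \<subseteq> {u. D u \<noteq> bot}"
    using A by (metis (mono_tags, lifting) Collect_mono bot_unique)
  with D have "finite_lset A"
    unfolding finite_lset_def by (rule rev_finite_subset)
  moreover have "A \<le> D" "rational_lset A"
    using A by (simp_all add: le_fun_def rational_lset_def)
  moreover have "c \<le> subsethood imp D A"
    unfolding subsethood_def using A by (intro INF_greatest) (simp add: less_imp_le)
  ultimately show thesis
    using that by blast
qed

end

theorem theorem4:
  fixes tensor imp :: "unit_interval \<Rightarrow> unit_interval \<Rightarrow> unit_interval"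
    and C :: "('v :: {countable, infinite}) lset \<Rightarrow> 'v lset"
  assumes "residuated_lattice_01 tensor imp"
    and "\<And>a X. X \<noteq> {} \<Longrightarrow> imp a (Sup X) = (SUP b\<in>X. imp a b)"
    and "L_closure_operator imp C"
    and "finitary C"
  shows "\<exists>\<Sigma> :: 'v fml set. is_theory \<Sigma> \<and> C = theory_closure tensor imp \<Sigma>"
proof -
  interpret residuated_lattice_01 tensor imp by fact
  note C = assms(3)
  define \<Sigma> where "\<Sigma> = {(A, B). is_formula (A, B) \<and> B \<le> C A}"
  have rational_le: "C A v \<le> iter tensor imp \<Sigma> e 1 v"
    if A: "A \<le> e" "finite_lset A" "rational_lset A" for A e v
  proof (rule le_if_rationals_below_le)
    fix q assume q: "real_of_unit q \<in> \<rat>" "q < C A v"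
    \<comment> \<open>The singleton of degree \<open>q\<close> at \<open>v\<close>. As A \<subseteq>
      e, the formula A \<Rightarrow> B fires to degree \<open>top\<close> and delivers
      \<open>q\<close> in one step.\<close>
    define B where "B = (\<lambda>u. if u = v then q else bot)"
    have "finite_lset B"
      unfolding finite_lset_def by (rule finite_subset[of _ "{v}"]) (auto simp: B_def)
    then have "(A, B) \<in> \<Sigma>"
      using A q by (auto simp: \<Sigma>_def is_formula_def rational_lset_def B_def le_fun_def)
    then have "scale_lset tensor (subsethood imp A e) B \<le> iter tensor imp \<Sigma> e 1"
      by (auto intro!: le_supI2 SUP_upper2[of "(A, B)"])
    then have "scale_lset tensor (subsethood imp A e) B v \<le> iter tensor imp \<Sigma> e 1 v"
      by (rule le_funD)
    then show "q \<le> iter tensor imp \<Sigma> e 1 v"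
      by (simp add: scale_lset_def subsethood_eq_top[OF A(1)] B_def)
  qed
  have finite_le: "C D v \<le> iter tensor imp \<Sigma> e 1 v"
    if D: "D \<le> e" "finite_lset D" for D e v
  proof -
    \<comment> \<open>The inequality is recast as a residuum equal to \<open>top\<close>, so that
      approximations of \<open>D\<close> to each degree \<open>c < top\<close> suffice.\<close>
    have "top \<le> imp (C D v) (iter tensor imp \<Sigma> e 1 v)"
    proof (rule le_if_rationals_below_le)
      fix c :: unit_interval assume "c < top"
      then obtain A where A: "A \<le> D" "finite_lset A" "rational_lset A" "c \<le> subsethood imp D A"
        using rational_subset_approx[OF assms(2) D(2)] by blast
      have "tensor c (C D v) \<le> tensor (subsethood imp D A) (C D v)"
        using A(4) by (intro tensor_mono) auto
      also have "\<dots> \<le> C A v"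
        by (rule tensor_subsethood_closure_le[OF C])
      also have "\<dots> \<le> iter tensor imp \<Sigma> e 1 v"
        using A D by (intro rational_le) auto
      finally show "c \<le> imp (C D v) (iter tensor imp \<Sigma> e 1 v)"
        by (simp only: adjointness)
    qed
    then show ?thesis
      by (simp only: top_unique imp_eq_top_iff)
  qed
  have "C e = theory_closure tensor imp \<Sigma> e" for e
  proof (rule antisym)
    have "C e = Sup {C D | D. D \<le> e \<and> finite_lset D}"
      using assms(4) unfolding finitary_def by blast
    also have "\<dots> \<le> iter tensor imp \<Sigma> e 1"
      using finite_le by (blast intro: Sup_least le_funI)
    also have "\<dots> \<le> theory_closure tensor imp \<Sigma> e"
      unfolding theory_closure_def by (rule SUP_upper) simp
    finally show "C e \<le> theory_closure tensor imp \<Sigma> e" .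
    show "theory_closure tensor imp \<Sigma> e \<le> C e"
      unfolding theory_closure_def
      by (intro SUP_least iter_le_closure[OF C]) (simp add: \<Sigma>_def)
  qed
  moreover have "is_theory \<Sigma>"
    by (auto simp: is_theory_def \<Sigma>_def)
  ultimately show ?thesis by blast
qed

end
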